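(* Let $m_d=\sqrt{\frac2\pi}\sqrt{\frac{d}{d-1}}$. For every dimension $d=2^m$ with $d\ge8$ and every $t\in[0,1-m_d]$, \[ \sup_{u\in S^{d-1}}W_1\bigl(T(u),X(u)\bigr)\ge \sqrt{2(1-m_d-t)}\,\bigl(1-e^{-(d-1)t^2/2}\bigr). \]
   Context: $H$ is the unnormalized $d\times d$ Walsh--Hadamard matrix ($H_1=(1)$, $H_{2n}=\begin{pmatrix}H_n&H_n\\H_n&-H_n\end{pmatrix}$). $D^{(1)},D^{(2)}$ are independent diagonal matrices with i.i.d. Rademacher diagonal entries. For deterministic $u\in S^{d-1}$ (the Euclidean unit sphere), $T(u)=\frac1d HD^{(1)}HD^{(2)}u$ and $X(u)=Ru$, with $R$ Haar-distributed on the orthogonal group $\mathcal O(d)$. For random vectors $Y,Z$ in $\mathbb{R}^d$, $W_1(Y,Z)=\sup_{f}|\mathbb{E}f(Y)-\mathbb{E}f(Z)|$, the supremum over all $1$-Lipschitz $f:\mathbb{R}^d\to\mathbb{R}$ with respect to the Euclidean norm (equivalently, the infimum of $\mathbb{E}\|Y'-Z'\|_2$ over couplings). *)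

theory Defs
  imports "HOL-Analysis.Analysis" "HOL-Probability.Probability"
begin

text \<open>Unnormalised Walsh--Hadamard matrix of size 2^k, indices 0..2^k-1, via the block recursion
  H_1 = (1), H_2n = [[H_n, H_n],[H_n, -H_n]].\<close>
fun hadamard :: "nat \<Rightarrow> nat \<Rightarrow> nat \<Rightarrow> real" where
  "hadamard 0 i j = 1"
| "hadamard (Suc k) i j =
     (if 2^k \<le> i \<and> 2^k \<le> j then - hadamard k (i - 2^k) (j - 2^k)
      else hadamard k (i mod 2^k) (j mod 2^k))"

text \<open>The d x d Hadamard matrix on R^d = real^'n, where ix enumerates the coordinates as 0..d-1.\<close>
definition hadamard_mat :: "nat \<Rightarrow> ('n::finite \<Rightarrow> nat) \<Rightarrow> real^'n^'n" where
  "hadamard_mat m ix = (\<chi> i j. hadamard m (ix i) (ix j))"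

definition diag_mat :: "real^'n \<Rightarrow> real^'n^'n" where
  "diag_mat e = (\<chi> i j. if i = j then e $ i else 0)"

definition rademacher_vec :: "(real^'n::finite) pmf" where
  "rademacher_vec = map_pmf vec_lambda (Pi_pmf UNIV 0 (\<lambda>_. pmf_of_set {-1, 1}))"

definition T_law :: "nat \<Rightarrow> ('n::finite \<Rightarrow> nat) \<Rightarrow> real^'n \<Rightarrow> (real^'n) measure" where
  "T_law m ix u = measure_pmf (map_pmf
     (\<lambda>(e1, e2). (1 / real CARD('n)) *\<^sub>R
        ((hadamard_mat m ix ** diag_mat e1 ** hadamard_mat m ix ** diag_mat e2) *v u))
     (pair_pmf rademacher_vec rademacher_vec))"

definition haar_orthogonal :: "(real^'n::finite^'n) measure \<Rightarrow> bool" where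
  "haar_orthogonal M \<longleftrightarrow> prob_space M \<and> sets M = sets borel
     \<and> emeasure M {R. orthogonal_matrix R} = 1
     \<and> (\<forall>Q. orthogonal_matrix Q \<longrightarrow> distr M borel (\<lambda>R. Q ** R) = M)"

definition X_law :: "(real^'n::finite^'n) measure \<Rightarrow> real^'n \<Rightarrow> (real^'n) measure" where
  "X_law M u = distr M borel (\<lambda>R. R *v u)"

definition W1 :: "(real^'n::finite) measure \<Rightarrow> (real^'n) measure \<Rightarrow> real" where
  "W1 P Q = (SUP f \<in> {f. 1-lipschitz_on UNIV f}. \<bar>(\<integral>x. f x \<partial>P) - (\<integral>x. f x \<partial>Q)\<bar>)"

definition m_d :: "nat \<Rightarrow> real" where
  "m_d d = sqrt (2 / pi) * sqrt (real d / (real d - 1))"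

end

(* Take u = e_k. With A = H / sqrt d, which is orthogonal, T(u) = A D A D' u, and the entries of
   D A D' e_k are all +-1 / sqrt d, so T(u) always lies in the image under A of the cube
   {+-1 / sqrt d}^d. By rotation invariance the distance of X(u) to that image has the law of
   the distance of X(u) to the cube itself, which is at least sqrt (2 (1 - Z)) with
   Z = |X(u)|_1 / sqrt d.

   Levy concentration is not needed for E sqrt (1 - Z): two moments of Z are enough.
   Rotating a coordinate plane by a uniform angle gives E |x_i x_j| = 2 / (pi d), hence E Z^2
   exactly; comparing with a Gaussian vector gives E Z >= sqrt (2 / pi). Hence E Z <= m_d and
   Var Z <= 1 / (2 d), and the quadratic minorant sqrt y >= (3 y - y^2) / 2 finishes the proof. *)
theory Submission
  imports Defs
begin

section \<open>The Hadamard side\<close>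

lemma hadamard_commute: "hadamard k i j = hadamard k j i"
  by (induction k arbitrary: i j) auto

lemma abs_hadamard [simp]: "\<bar>hadamard k i j\<bar> = 1"
  by (induction k arbitrary: i j) auto

text \<open>Both halves of a row of H_2n are, up to sign, the same row of H_n, and only the right
  half of a lower row is negated. Inner products therefore pick up the factor
  \<open>1 + s i * s j\<close>: it is 2 for rows in the same half and 0 otherwise, which separates
  rows with equal residue mod n.\<close>

lemma hadamard_orthogonal_rows:
  assumes "i < 2 ^ k" "j < 2 ^ k"
  shows "(\<Sum>l<2 ^ k. hadamard k i l * hadamard k j l) = (if i = j then 2 ^ k else 0)"
  using assms
proof (induction k arbitrary: i j)
  case 0
  then show ?case by simp
next
  case (Suc k)
  define n :: nat where "n = 2 ^ k"
  define s :: "nat \<Rightarrow> real" where "s i = (if n \<le> i then -1 else 1)" for i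
  have n: "n > 0" by (simp add: n_def)
  have low: "hadamard (Suc k) i l = hadamard k (i mod n) l" if "l < n" for i l
    using that by (simp add: n_def)
  have high: "hadamard (Suc k) i (l + n) = s i * hadamard k (i mod n) l"
    if "l < n" "i < 2 * n" for i l
    using that by (cases "n \<le> i") (simp_all add: n_def s_def mod_if)
  have ij: "i < 2 * n" "j < 2 * n" using Suc.prems by (auto simp: n_def)
  have split: "{..<2 ^ Suc k} = {..<n} \<union> {n..<n + n}"
    by (auto simp: n_def)
  have "(\<Sum>l<2 ^ Suc k. hadamard (Suc k) i l * hadamard (Suc k) j l) =
      (\<Sum>l<n. hadamard (Suc k) i l * hadamard (Suc k) j l) +
      (\<Sum>l\<in>{n..<n + n}. hadamard (Suc k) i l * hadamard (Suc k) j l)"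
    unfolding split by (rule sum.union_disjoint) auto
  also have "(\<Sum>l\<in>{n..<n + n}. hadamard (Suc k) i l * hadamard (Suc k) j l) =
      (\<Sum>l<n. hadamard (Suc k) i (l + n) * hadamard (Suc k) j (l + n))"
    using sum.shift_bounds_nat_ivl[of "\<lambda>l. hadamard (Suc k) i l * hadamard (Suc k) j l" 0 n n]
    by (simp add: atLeast0LessThan)
  also have "\<dots> = s i * s j * (\<Sum>l<n. hadamard k (i mod n) l * hadamard k (j mod n) l)"
    using ij by (auto simp: high sum_distrib_left intro!: sum.cong simp del: hadamard.simps)
  also have "(\<Sum>l<n. hadamard (Suc k) i l * hadamard (Suc k) j l) =
      (\<Sum>l<n. hadamard k (i mod n) l * hadamard k (j mod n) l)"
    by (auto simp: low intro!: sum.cong simp del: hadamard.simps)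
  also have "(\<Sum>l<n. hadamard k (i mod n) l * hadamard k (j mod n) l) =
      (if i mod n = j mod n then n else 0)"
    using Suc.IH[of "i mod n" "j mod n"] n by (simp add: n_def)
  finally have eq: "(\<Sum>l<2 ^ Suc k. hadamard (Suc k) i l * hadamard (Suc k) j l) =
      (1 + s i * s j) * (if i mod n = j mod n then n else 0)"
    by (simp add: algebra_simps)
  show ?case
    unfolding eq using ij by (auto simp: s_def n_def mod_if split: if_splits)
qed

lemma orthogonal_matrix_hadamard:
  fixes ix :: "'n::finite \<Rightarrow> nat"
  assumes card: "CARD('n) = 2 ^ m" and bij: "bij_betw ix UNIV {..<CARD('n)}"
  shows "orthogonal_matrix ((1 / sqrt CARD('n)) *\<^sub>R hadamard_mat m ix)"
proof -
  have ix: "ix i < 2 ^ m" for i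
    using bij_betwE[OF bij] card by auto
  have inj: "ix i = ix j \<longleftrightarrow> i = j" for i j
    using bij by (auto simp: bij_betw_def inj_on_def)
  \<comment> \<open>The criterion \<open>transpose Q ** Q = mat 1\<close> pairs columns; symmetry of
    H turns them into rows.\<close>
  have "(\<Sum>l\<in>UNIV. hadamard m (ix l) (ix i) * hadamard m (ix l) (ix j)) =
      (if i = j then 2 ^ m else 0)" for i j
  proof -
    have "(\<Sum>l\<in>UNIV. hadamard m (ix l) (ix i) * hadamard m (ix l) (ix j)) =
        (\<Sum>l<CARD('n). hadamard m (ix i) l * hadamard m (ix j) l)"
      using sum.reindex_bij_betw[OF bij, of "\<lambda>l. hadamard m (ix i) l * hadamard m (ix j) l"]
      by (simp add: hadamard_commute)
    then show ?thesis
      using hadamard_orthogonal_rows[OF ix ix, of i j] card by (simp add: inj)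
  qed
  then show ?thesis
    unfolding orthogonal_matrix card
    by (simp add: vec_eq_iff matrix_matrix_mult_def transpose_def hadamard_mat_def mat_def
        flip: sum_divide_distrib)
qed

section \<open>Isometries, random signs, and the cube that carries T(e_k)\<close>

lemma norm_orthogonal_matrix_vector:
  fixes Q :: "real^'n^'n"
  assumes "orthogonal_matrix Q"
  shows "norm (Q *v x) = norm x"
  using assms orthogonal_transformation_matrix[of "(*v) Q"] orthogonal_transformation_norm
  by (simp add: matrix_of_matrix_vector_mul)

lemma transpose_mult_vector_cancel:
  fixes Q :: "real^'n^'n"
  assumes "orthogonal_matrix Q"
  shows "transpose Q *v (Q *v x) = x"
  using assms by (simp add: orthogonal_matrix matrix_vector_mul_assoc)

lemma abs_rademacher_vec:
  assumes "e \<in> set_pmf rademacher_vec"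
  shows "\<bar>e $ i\<bar> = 1"
proof -
  obtain x where "e = vec_lambda x" "\<And>i. x i = -1 \<or> x i = 1"
    using assms by (auto simp: rademacher_vec_def set_Pi_pmf PiE_dflt_def)
  then show ?thesis by (metis abs_1 abs_minus_cancel vec_lambda_beta)
qed

lemma diag_mat_vector: "(diag_mat e *v u) $ i = e $ i * u $ i"
  by (simp add: diag_mat_def matrix_vector_mult_def if_distrib[of "\<lambda>x. x * _"] cong: if_cong)

text \<open>Only the vertices, scaled to lie on the unit sphere.\<close>

definition cube :: "(real^'n) set" where
  "cube = {y. \<forall>i. \<bar>y $ i\<bar> = 1 / sqrt CARD('n)}"

locale normalized_hadamard =
  fixes m :: nat and ix :: "'n::finite \<Rightarrow> nat"
  assumes card: "CARD('n) = 2 ^ m" and bij: "bij_betw ix UNIV {..<CARD('n)}"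
begin

definition A :: "real^'n^'n" where "A = (1 / sqrt CARD('n)) *\<^sub>R hadamard_mat m ix"

lemma orthogonal_A: "orthogonal_matrix A"
  unfolding A_def by (rule orthogonal_matrix_hadamard[OF card bij])

lemma T_eq:
  "(1 / real CARD('n)) *\<^sub>R ((hadamard_mat m ix ** diag_mat e1 ** hadamard_mat m ix ** diag_mat e2) *v u)
    = A *v (diag_mat e1 *v (A *v (diag_mat e2 *v u)))"
  unfolding A_def
  by (simp add: matrix_vector_mult_scaleR flip: scaleR_matrix_vector_assoc matrix_vector_mul_assoc)

lemma norm_diag_rademacher:
  assumes "e \<in> set_pmf rademacher_vec"
  shows "norm (diag_mat e *v (u::real^'n)) = norm u"
  using abs_rademacher_vec[OF assms]
  by (simp add: norm_vec_def L2_set_def diag_mat_vector abs_mult power_mult_distrib)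


lemma AE_norm_T_law: "AE x in T_law m ix u. norm x = norm u"
  unfolding T_law_def
  by (auto simp: AE_measure_pmf_iff T_eq norm_orthogonal_matrix_vector orthogonal_A norm_diag_rademacher)

text \<open>The inner signs multiply e_k by +-1, so \<open>A\<close> sends it to a column of
  \<open>A\<close> up to sign, with all entries of modulus 1 / sqrt d. The outer signs preserve the
  moduli, and the transpose undoes the last \<open>A\<close>.\<close>

lemma AE_T_law_axis: "AE x in T_law m ix (axis k 1). transpose A *v x \<in> cube"
proof -
  have "\<bar>(diag_mat e1 *v (A *v (diag_mat e2 *v axis k 1))) $ i\<bar> = 1 / sqrt CARD('n)"
    if "e1 \<in> set_pmf rademacher_vec" "e2 \<in> set_pmf rademacher_vec" for e1 e2 i
  proof -
    have "diag_mat e2 *v axis k 1 = e2 $ k *\<^sub>R axis k 1"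
      by (simp add: vec_eq_iff diag_mat_vector axis_def)
    then have "A *v (diag_mat e2 *v axis k 1) = e2 $ k *\<^sub>R (column k A)"
      by (simp add: matrix_vector_mult_scaleR matrix_vector_mult_basis)
    then show ?thesis
      using that by (simp add: diag_mat_vector abs_mult abs_rademacher_vec column_def A_def hadamard_mat_def)
  qed
  then show ?thesis
    unfolding T_law_def
    by (auto simp: AE_measure_pmf_iff T_eq transpose_mult_vector_cancel orthogonal_A cube_def
        simp del: transpose_matrix_vector)
qed

end

text \<open>For unit vectors |x - y|^2 = 2 - 2 (x . y), and against a vertex y the inner product is
  at most the l1 norm of x divided by sqrt d.\<close>

lemma infdist_cube_ge:
  fixes x :: "real^'n"
  assumes "norm x = 1"
  shows "sqrt (2 * (1 - (\<Sum>i\<in>UNIV. \<bar>x $ i\<bar>) / sqrt CARD('n))) \<le> infdist x cube"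
proof -
  have ne: "(cube :: (real^'n) set) \<noteq> {}"
    unfolding cube_def by (auto intro!: exI[of _ "\<chi> i. 1 / sqrt CARD('n)"])
  have "sqrt (2 * (1 - (\<Sum>i\<in>UNIV. \<bar>x $ i\<bar>) / sqrt CARD('n))) \<le> dist x y" if "y \<in> cube" for y
  proof -
    have y: "\<bar>y $ i\<bar> = 1 / sqrt CARD('n)" for i
      using that by (simp add: cube_def)
    have "(y $ i)\<^sup>2 = 1 / CARD('n)" for i
      using y[of i] by (metis power2_abs power_one_over real_sqrt_pow2 of_nat_0_le_iff)
    then have "y \<bullet> y = 1"
      by (simp add: inner_vec_def flip: power2_eq_square)
    moreover have "x \<bullet> x = 1"
      using assms by (simp add: dot_square_norm)
    moreover have "x \<bullet> y \<le> (\<Sum>i\<in>UNIV. \<bar>x $ i\<bar>) / sqrt CARD('n)"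
      unfolding inner_vec_def sum_divide_distrib
    proof (rule sum_mono)
      fix i
      have "x $ i \<bullet> y $ i \<le> \<bar>x $ i\<bar> * \<bar>y $ i\<bar>" 
        by (metis abs_ge_self abs_mult inner_real_def)
      then show "x $ i \<bullet> y $ i \<le> \<bar>x $ i\<bar> / sqrt CARD('n)" by (simp add: y)
    qed
    moreover have "(dist x y)\<^sup>2 = x \<bullet> x + y \<bullet> y - 2 * (x \<bullet> y)"
      by (simp add: dist_norm power2_norm_eq_inner inner_diff inner_commute)
    ultimately show ?thesis
      by (intro real_le_lsqrt) auto
  qed
  then show ?thesis
    using ne by (auto simp: infdist_notempty intro!: cINF_greatest)
qed

section \<open>Gaussian vectors\<close>

abbreviation std_gaussian :: "('n::finite \<Rightarrow> real) measure" where
  "std_gaussian \<equiv> PiM UNIV (\<lambda>_. density lborel std_normal_density)"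

lemma prob_space_std_normal: "prob_space (density lborel std_normal_density)"
  by (rule prob_space_normal_density) simp

lemma prob_space_std_gaussian: "prob_space std_gaussian"
  by (intro prob_space_PiM prob_space_std_normal)

lemma distr_std_gaussian_component:
  "distr (std_gaussian :: ('n::finite \<Rightarrow> real) measure) borel (\<lambda>g. g i) = density lborel std_normal_density"
proof -
  have "distr (std_gaussian :: ('n \<Rightarrow> real) measure) (density lborel std_normal_density) (\<lambda>g. g i) =
      density lborel std_normal_density"
    by (rule distr_PiM_component) (auto intro: prob_space_std_normal)
  then show ?thesis
    by (metis distr_cong sets_density sets_lborel)
qed

lemma distributed_std_gaussian_component:
  "distributed (std_gaussian :: ('n::finite \<Rightarrow> real) measure) lborel (\<lambda>g. g i) std_normal_density"
proof -
  have "distr (std_gaussian :: ('n::finite \<Rightarrow> real) measure) lborel (\<lambda>g. g i) = distr std_gaussian borel (\<lambda>g. g i)"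
    by (rule distr_cong) auto
  then have "distr (std_gaussian :: ('n \<Rightarrow> real) measure) lborel (\<lambda>g. g i) = density lborel std_normal_density"
    by (simp only: distr_std_gaussian_component)
  moreover have "(\<lambda>g. g i) \<in> measurable (std_gaussian :: ('n \<Rightarrow> real) measure) lborel"
    using measurable_component_singleton[of i UNIV "\<lambda>_. density lborel std_normal_density"] by simp
  ultimately show ?thesis
    by (simp add: distributed_def)
qed

lemma indep_vars_std_gaussian:
  "prob_space.indep_vars (std_gaussian :: ('n::finite \<Rightarrow> real) measure) (\<lambda>_. borel) (\<lambda>i g. g i) UNIV"
proof -
  interpret prob_space "std_gaussian :: ('n \<Rightarrow> real) measure"
    by (rule prob_space_std_gaussian)
  have sets: "sets (PiM (UNIV::'n set) (\<lambda>_. borel :: real measure)) = sets (std_gaussian :: ('n \<Rightarrow> real) measure)"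
    by (intro sets_PiM_cong) auto
  show ?thesis
    by (subst indep_vars_iff_distr_eq_PiM')
       (auto simp: distr_std_gaussian_component restrict_UNIV intro!: distr_id2[OF sets])
qed

lemma distributed_std_gaussian_linear:
  fixes x :: "real^'n::finite"
  assumes "x \<noteq> 0"
  shows "distributed std_gaussian lborel (\<lambda>g. \<Sum>i\<in>UNIV. x $ i * g i) (normal_density 0 (norm x))"
proof -
  interpret prob_space "std_gaussian :: ('n \<Rightarrow> real) measure"
    by (rule prob_space_std_gaussian)
  \<comment> \<open>\<open>sum_indep_normal\<close> requires positive standard deviations, so
    coordinates with coefficient 0 are dropped.\<close>
  define I where "I = {i. x $ i \<noteq> 0}"
  have "distributed std_gaussian lborel (\<lambda>g. \<Sum>i\<in>I. x $ i * g i)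
      (normal_density (\<Sum>i\<in>I. 0) (sqrt (\<Sum>i\<in>I. \<bar>x $ i\<bar>\<^sup>2)))"
  proof (rule sum_indep_normal)
    show "I \<noteq> {}" using assms by (auto simp: I_def vec_eq_iff)
    show "indep_vars (\<lambda>i. borel) (\<lambda>i g. x $ i * g i) I"
      using indep_vars_compose2[OF indep_vars_subset[OF indep_vars_std_gaussian, of I],
          of "\<lambda>i y. x $ i * y" "\<lambda>_. borel"] by simp
    show "distributed std_gaussian lborel (\<lambda>g. x $ i * g i) (normal_density 0 \<bar>x $ i\<bar>)"
      if "i \<in> I" for i
      using normal_density_affine[OF distributed_std_gaussian_component, of "x $ i" 0 i] that
      by (simp add: I_def)
  qed (auto simp: I_def)
  moreover have "(\<Sum>i\<in>I. x $ i * g i) = (\<Sum>i\<in>UNIV. x $ i * g i)" for g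
    by (intro sum.mono_neutral_left) (auto simp: I_def)
  moreover have "(\<Sum>i\<in>I. (x $ i)\<^sup>2) = (\<Sum>i\<in>UNIV. (x $ i)\<^sup>2)"
    by (intro sum.mono_neutral_left) (auto simp: I_def)
  ultimately show ?thesis
    by (simp add: norm_vec_def L2_set_def)
qed

text \<open>The linear form is centred normal with standard deviation \<open>norm x\<close>. The
  nonnegative integral lets the order of integration be exchanged later without an integrability
  proof.\<close>

lemma nn_integral_gaussian_abs_inner:
  fixes x :: "real^'n::finite"
  shows "(\<integral>\<^sup>+ g. ennreal \<bar>\<Sum>i\<in>UNIV. x $ i * g i\<bar> \<partial>std_gaussian) = ennreal (sqrt (2 / pi) * norm x)"
proof (cases "x = 0")
  case True
  then show ?thesis by simp
next
  case False
  have "(\<integral>\<^sup>+ g. ennreal \<bar>\<Sum>i\<in>UNIV. x $ i * g i\<bar> \<partial>std_gaussian) =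
      (\<integral>\<^sup>+ y. ennreal (normal_density 0 (norm x) y) * ennreal \<bar>y\<bar> \<partial>lborel)"
    by (rule distributed_nn_integral[OF distributed_std_gaussian_linear[OF False], symmetric]) simp
  also have "\<dots> = ennreal (sqrt (2 / pi) * norm x)"
    using normal_moment_abs_odd[of "norm x" 0 0] False
    by (simp add: has_bochner_integral_iff nn_integral_eq_integral mult_ac flip: ennreal_mult)
  finally show ?thesis .
qed

lemma nn_integral_gaussian_square:
  "(\<integral>\<^sup>+ g. ennreal ((g i)\<^sup>2) \<partial>(std_gaussian :: ('n::finite \<Rightarrow> real) measure)) = 1"
proof -
  have "(\<integral>\<^sup>+ g. ennreal ((g i)\<^sup>2) \<partial>(std_gaussian :: ('n::finite \<Rightarrow> real) measure)) =
      (\<integral>\<^sup>+ y. ennreal (std_normal_density y) * ennreal (y\<^sup>2) \<partial>lborel)"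
    by (rule distributed_nn_integral[OF distributed_std_gaussian_component, symmetric]) simp
  also have "\<dots> = 1"
    using std_normal_moment_even[of 1]
    by (simp add: has_bochner_integral_iff nn_integral_eq_integral flip: ennreal_mult)
  finally show ?thesis .
qed

section \<open>Rotation invariant laws on the sphere\<close>

text \<open>This is all that is retained of the law of X(u): the moments below follow from
  invariance and the support, with no explicit surface measure.\<close>

locale rotation_invariant = prob_space N for N :: "(real^'n::finite) measure" +
  assumes sets_N [measurable_cong]: "sets N = sets borel"
    and AE_norm: "AE x in N. norm x = 1"
    and invariant: "orthogonal_matrix Q \<Longrightarrow> distr N borel ((*v) Q) = N"
begin

lemma measurable_continuous:
  fixes f :: "real^'n \<Rightarrow> real"
  assumes "continuous_on UNIV f"
  shows "f \<in> borel_measurable N"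
  using borel_measurable_continuous_onI[OF assms] by simp

text \<open>The law lives on the compact sphere, where a continuous function is bounded; this
  settles the integrability questions below.\<close>

lemma integrable_continuous:
  fixes f :: "real^'n \<Rightarrow> real"
  assumes "continuous_on UNIV f"
  shows "integrable N f"
proof -
  have "compact (f ` sphere 0 1)"
    using assms by (intro compact_continuous_image compact_sphere) (auto intro: continuous_on_subset)
  then obtain B where B: "norm (f x) \<le> B" if "norm x = 1" for x
    by (force dest!: compact_imp_bounded simp: bounded_iff)
  show ?thesis
    using AE_norm B by (intro integrable_const_bound[of _ B] measurable_continuous assms) auto
qed

lemma integral_rotate:
  fixes f :: "real^'n \<Rightarrow> real"
  assumes "orthogonal_transformation h" "continuous_on UNIV f"
  shows "(\<integral>x. f (h x) \<partial>N) = (\<integral>x. f x \<partial>N)"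
proof -
  have orth: "orthogonal_matrix (matrix h)" and h: "h = (*v) (matrix h)"
    using assms(1) by (auto simp: orthogonal_transformation_matrix matrix_vector_mul)
  have meas: "(*v) (matrix h) \<in> measurable N borel"
    by (auto intro!: borel_measurable_continuous_onI linear_continuous_on 
       simp: measurable_cong_sets[OF sets_N refl])
  have "(\<integral>x. f x \<partial>N) = (\<integral>x. f x \<partial>(distr N borel ((*v) (matrix h))))"
    by (simp add: invariant[OF orth])
  also have "\<dots> = (\<integral>x. f (matrix h *v x) \<partial>N)"
    by (rule integral_distr[OF meas]) (rule borel_measurable_continuous_onI[OF assms(2)])
  also have "\<dots> = (\<integral>x. f (h x) \<partial>N)"
    using h by metis
  finally show ?thesis ..
qed

text \<open>Some orthogonal h maps w to v; replace x by h x and use h x . h w = x . w.\<close>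

lemma integral_inner_cong:
  fixes \<phi> :: "real \<Rightarrow> real"
  assumes "norm v = norm w" "continuous_on UNIV \<phi>"
  shows "(\<integral>x. \<phi> (x \<bullet> v) \<partial>N) = (\<integral>x. \<phi> (x \<bullet> w) \<partial>N)"
proof -
  obtain h where h: "orthogonal_transformation h" "h w = v"
    using orthogonal_transformation_exists assms(1) by metis
  have "(\<integral>x. \<phi> (x \<bullet> v) \<partial>N) = (\<integral>x. \<phi> (h x \<bullet> v) \<partial>N)"
    by (rule integral_rotate[OF h(1), symmetric])
       (auto intro!: continuous_intros continuous_on_compose2[OF assms(2)])
  then show ?thesis
    using h by (auto simp: orthogonal_transformation_def)
qed

text \<open>Here \<open>undefined\<close> merely picks some coordinate; by invariance every unit
  vector gives the same value.\<close>

definition mean_abs :: real where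
  "mean_abs = (\<integral>x. \<bar>x \<bullet> axis undefined 1\<bar> \<partial>N)"

lemma mean_abs_nonneg: "0 \<le> mean_abs"
  by (simp add: mean_abs_def)

lemma integral_abs_inner: "(\<integral>x. \<bar>x \<bullet> v\<bar> \<partial>N) = mean_abs * norm v"
proof -
  have "(\<integral>x. \<bar>x \<bullet> v\<bar> \<partial>N) = (\<integral>x. \<bar>x \<bullet> (norm v *\<^sub>R axis undefined 1)\<bar> \<partial>N)"
    by (rule integral_inner_cong) (auto intro!: continuous_intros)
  then show ?thesis by (simp add: mean_abs_def abs_mult)
qed

lemma integral_abs_component: "(\<integral>x. \<bar>x $ i\<bar> \<partial>N) = mean_abs"
  using integral_abs_inner[of "axis i 1"] by (simp add: inner_axis)

text \<open>By invariance the d second moments agree, and they add up to E |x|^2 = 1.\<close>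

lemma integral_square_component: "(\<integral>x. (x $ i)\<^sup>2 \<partial>N) = 1 / CARD('n)"
proof -
  have eq: "(\<integral>x. (x $ j)\<^sup>2 \<partial>N) = (\<integral>x. (x $ i)\<^sup>2 \<partial>N)" for j
    using integral_inner_cong[of "axis j 1" "axis i 1" "\<lambda>y. y\<^sup>2"]
    by (simp add: inner_axis continuous_on_power)
  have "1 = (\<integral>x. (1::real) \<partial>N)" by (simp add: prob_space)
  also have "\<dots> = (\<integral>x. (\<Sum>j\<in>UNIV. (x $ j)\<^sup>2) \<partial>N)"
    using AE_norm by (intro integral_cong_AE) (auto intro!: measurable_continuous continuous_intros
      simp: norm_vec_def L2_set_def)
  also have "\<dots> = (\<Sum>j\<in>UNIV. (\<integral>x. (x $ j)\<^sup>2 \<partial>N))"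
    by (intro Bochner_Integration.integral_sum integrable_continuous continuous_intros)
  also have "\<dots> = CARD('n) * (\<integral>x. (x $ i)\<^sup>2 \<partial>N)"
    by (subst sum.cong[OF refl eq]) simp
  finally show ?thesis by (simp add: field_simps)
qed

text \<open>Averaging \<open>\<bar>x \<bullet> g\<bar>\<close> over both \<open>x\<close> and an independent standard Gaussian \<open>g\<close> gives
  \<open>sqrt (2 / pi) = mean_abs * E (norm g)\<close>, and \<open>E (norm g) \<le> sqrt d\<close>.\<close>

lemma mean_abs_ge: "sqrt (2 / pi) \<le> sqrt CARD('n) * mean_abs"
proof -
  let ?G = "std_gaussian :: ('n \<Rightarrow> real) measure"
  let ?d = "real CARD('n)"
  interpret G: prob_space ?G by (rule prob_space_std_gaussian)
  interpret NG: pair_prob_space N ?G ..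
  have d: "?d > 0" by simp
  have [measurable]: "(\<lambda>x. x $ i) \<in> borel_measurable N" for i
    by (intro measurable_continuous continuous_intros)
  have [measurable]: "(\<lambda>g. g i) \<in> borel_measurable ?G" for i
    using distributed_measurable[OF distributed_std_gaussian_component, of i] by simp
  have "ennreal (sqrt (2 / pi)) = (\<integral>\<^sup>+ x. ennreal (sqrt (2 / pi)) \<partial>N)"
    by (simp add: emeasure_space_1)
  also have "\<dots> = (\<integral>\<^sup>+ x. (\<integral>\<^sup>+ g. ennreal \<bar>\<Sum>i\<in>UNIV. x $ i * g i\<bar> \<partial>?G) \<partial>N)"
    using AE_norm by (intro nn_integral_cong_AE) (auto simp: nn_integral_gaussian_abs_inner)
  also have "\<dots> = (\<integral>\<^sup>+ g. (\<integral>\<^sup>+ x. ennreal \<bar>\<Sum>i\<in>UNIV. x $ i * g i\<bar> \<partial>N) \<partial>?G)"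
    by (rule NG.Fubini'[symmetric]) measurable
  also have "\<dots> = (\<integral>\<^sup>+ g. ennreal (mean_abs * norm (vec_lambda g :: real^'n)) \<partial>?G)"
  proof (intro nn_integral_cong)
    fix g :: "'n \<Rightarrow> real"
    have "(\<integral>\<^sup>+ x. ennreal \<bar>\<Sum>i\<in>UNIV. x $ i * g i\<bar> \<partial>N) = (\<integral>\<^sup>+ x. ennreal \<bar>x \<bullet> vec_lambda g\<bar> \<partial>N)"
      by (simp add: inner_vec_def)
    also have "\<dots> = ennreal (\<integral>x. \<bar>x \<bullet> vec_lambda g\<bar> \<partial>N)"
      by (intro nn_integral_eq_integral integrable_continuous continuous_intros) auto
    finally show "(\<integral>\<^sup>+ x. ennreal \<bar>\<Sum>i\<in>UNIV. x $ i * g i\<bar> \<partial>N) =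
        ennreal (mean_abs * norm (vec_lambda g :: real^'n))"
      by (simp add: integral_abs_inner)
  qed
  \<comment> \<open>E |g| <= sqrt d is obtained from the pointwise bound r <= (d + r^2) / (2 sqrt d)
    together with E r^2 = d.\<close>
  also have "\<dots> \<le> (\<integral>\<^sup>+ g. ennreal (mean_abs / (2 * sqrt ?d)) * (ennreal ?d + (\<Sum>i\<in>UNIV. ennreal ((g i)\<^sup>2))) \<partial>?G)"
  proof (intro nn_integral_mono)
    fix g :: "'n \<Rightarrow> real"
    let ?r = "norm (vec_lambda g :: real^'n)"
    have r: "?r\<^sup>2 = (\<Sum>i\<in>UNIV. (g i)\<^sup>2)"
      by (simp add: norm_vec_def L2_set_def sum_nonneg)
    have "0 \<le> (?r - sqrt ?d)\<^sup>2" by simp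
    then have "2 * sqrt ?d * ?r \<le> ?d + ?r\<^sup>2"
      by (simp add: power2_diff algebra_simps)
    then have "mean_abs * ?r \<le> mean_abs / (2 * sqrt ?d) * (?d + ?r\<^sup>2)"
      using mult_left_mono[of "2 * sqrt ?d * ?r" "?d + ?r\<^sup>2" "mean_abs / (2 * sqrt ?d)"] d
      by (simp add: mean_abs_nonneg)
    then show "ennreal (mean_abs * ?r) \<le>
        ennreal (mean_abs / (2 * sqrt ?d)) * (ennreal ?d + (\<Sum>i\<in>UNIV. ennreal ((g i)\<^sup>2)))"
      unfolding r by (simp add: sum_ennreal mean_abs_nonneg sum_nonneg flip: ennreal_mult ennreal_plus)
  qed
  also have "\<dots> = ennreal (mean_abs / (2 * sqrt ?d)) * (ennreal ?d + ennreal ?d)"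
    by (simp add: nn_integral_cmult nn_integral_add nn_integral_sum nn_integral_gaussian_square
       G.emeasure_space_1 ennreal_of_nat_eq_real_of_nat del: sum_ennreal)
  also have "\<dots> = ennreal (mean_abs / (2 * sqrt ?d) * (?d + ?d))"
    by (simp add: mean_abs_nonneg flip: ennreal_mult ennreal_plus)
  also have "mean_abs / (2 * sqrt ?d) * (?d + ?d) = sqrt ?d * mean_abs"
    using d by (simp add: field_simps)
  finally show ?thesis
    by (simp add: mean_abs_nonneg)
qed

end

section \<open>Mean products of two coordinates, and the moments of the l1 norm\<close>

lemma has_integral_abs_sin_shift:
  assumes "0 \<le> \<beta>" "\<beta> \<le> pi"
  shows "((\<lambda>\<phi>. \<bar>sin (\<phi> + \<beta>)\<bar>) has_integral 2) {0..pi}"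
proof -
  \<comment> \<open>The shifted sine changes sign at \<open>pi - \<beta>\<close>; the two pieces
    contribute \<open>1 + cos \<beta>\<close> and \<open>1 - cos \<beta>\<close>, so the shift
    cancels.\<close>
  have "((\<lambda>\<phi>. sin (\<phi> + \<beta>)) has_integral (- cos (pi - \<beta> + \<beta>) - - cos (0 + \<beta>))) {0..pi - \<beta>}"
    using assms by (intro fundamental_theorem_of_calculus)
      (auto intro!: derivative_eq_intros simp flip: has_real_derivative_iff_has_vector_derivative)
  then have 1: "((\<lambda>\<phi>. \<bar>sin (\<phi> + \<beta>)\<bar>) has_integral (1 + cos \<beta>)) {0..pi - \<beta>}"
    using assms by (subst has_integral_cong[where g = "\<lambda>\<phi>. sin (\<phi> + \<beta>)"])
      (auto intro!: abs_of_nonneg sin_ge_zero)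
  have "((\<lambda>\<phi>. - sin (\<phi> + \<beta>)) has_integral (cos (pi + \<beta>) - cos (pi - \<beta> + \<beta>))) {pi - \<beta>..pi}"
    using assms by (intro fundamental_theorem_of_calculus)
      (auto intro!: derivative_eq_intros simp flip: has_real_derivative_iff_has_vector_derivative)
  then have 2: "((\<lambda>\<phi>. \<bar>sin (\<phi> + \<beta>)\<bar>) has_integral (1 - cos \<beta>)) {pi - \<beta>..pi}"
  proof (subst has_integral_cong[where g = "\<lambda>\<phi>. - sin (\<phi> + \<beta>)"])
    fix \<phi> assume "\<phi> \<in> {pi - \<beta>..pi}"
    then have "0 \<le> sin (\<phi> + \<beta> - pi)"
      using assms by (intro sin_ge_zero) auto
    then show "\<bar>sin (\<phi> + \<beta>)\<bar> = - sin (\<phi> + \<beta>)"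
      by (simp add: sin_diff)
  qed (use assms in simp)
  show ?thesis
    using has_integral_combine[OF _ _ 1 2] assms by simp
qed

text \<open>In polar form (p, r) = \<rho> (cos \<beta>, sin \<beta>) the integrand is \<rho> times a
  shifted |sin|. Negating both p and r leaves it unchanged, so r >= 0 and \<beta> in [0, pi] may be
  assumed.\<close>

lemma has_integral_abs_sin_cos:
  "((\<lambda>\<phi>. \<bar>sin \<phi> * p + cos \<phi> * r\<bar>) has_integral (2 * sqrt (p\<^sup>2 + r\<^sup>2))) {0..pi}"
proof -
  have *: "((\<lambda>\<phi>. \<bar>sin \<phi> * p + cos \<phi> * r\<bar>) has_integral (2 * sqrt (p\<^sup>2 + r\<^sup>2))) {0..pi}"
    if "0 \<le> r" for p r :: real
  proof (cases "p = 0 \<and> r = 0")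
    case False
    define \<rho> where "\<rho> = sqrt (p\<^sup>2 + r\<^sup>2)"
    have pos: "\<rho> > 0" using False by (auto simp: \<rho>_def sum_power2_gt_zero_iff)
    have sq: "(p / \<rho>)\<^sup>2 + (r / \<rho>)\<^sup>2 = 1"
      using pos False by (auto simp: \<rho>_def power_divide simp flip: add_divide_distrib)
    obtain \<beta> where \<beta>: "0 \<le> \<beta>" "\<beta> \<le> pi" "p / \<rho> = cos \<beta>" "r / \<rho> = sin \<beta>"
      using sincos_total_pi[OF _ sq] pos \<open>0 \<le> r\<close> by force
    have "p = \<rho> * cos \<beta>" "r = \<rho> * sin \<beta>" using \<beta> pos by (auto simp: field_simps)
    then have "sin \<phi> * p + cos \<phi> * r = \<rho> * sin (\<phi> + \<beta>)" for \<phi>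
      by (simp add: sin_add algebra_simps)
    then have "\<bar>sin \<phi> * p + cos \<phi> * r\<bar> = \<rho> * \<bar>sin (\<phi> + \<beta>)\<bar>" for \<phi>
      using pos by (simp add: abs_mult)
    then show ?thesis
      using has_integral_mult_right[OF has_integral_abs_sin_shift[OF \<beta>(1,2)], of \<rho>]
      by (simp add: \<rho>_def mult.commute)
  qed simp
  show ?thesis
  proof (cases "0 \<le> r")
    case False
    have "\<bar>sin \<phi> * - p + cos \<phi> * - r\<bar> = \<bar>sin \<phi> * p + cos \<phi> * r\<bar>" for \<phi>
      by (metis abs_minus_cancel minus_add_distrib mult_minus_right)
    then show ?thesis
      using *[of "- r" "- p"] False by simp
  qed (rule *)
qed

definition plane_rotation :: "'n::finite \<Rightarrow> 'n \<Rightarrow> real \<Rightarrow> real^'n \<Rightarrow> real^'n" where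
  "plane_rotation i j \<theta> x = (\<chi> k. if k = i then cos \<theta> * x $ i - sin \<theta> * x $ j
     else if k = j then sin \<theta> * x $ i + cos \<theta> * x $ j else x $ k)"

lemma orthogonal_plane_rotation:
  assumes "i \<noteq> j"
  shows "orthogonal_transformation (plane_rotation i j \<theta>)"
  unfolding orthogonal_transformation
proof (intro conjI allI)
  show "linear (plane_rotation i j \<theta>)"
    by (rule linearI) (auto simp: plane_rotation_def vec_eq_iff algebra_simps)
  fix x :: "real^'a"
  have split: "(\<Sum>k\<in>UNIV. f k) = f i + f j + (\<Sum>k\<in>UNIV - {i, j}. f k)" for f :: "'a \<Rightarrow> real"
    using assms by (simp add: sum.remove[of UNIV i] sum.remove[of "UNIV - {i}" j] Diff_insert2[symmetric])
  have "(cos \<theta> * x $ i - sin \<theta> * x $ j)\<^sup>2 + (sin \<theta> * x $ i + cos \<theta> * x $ j)\<^sup>2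
      = ((sin \<theta>)\<^sup>2 + (cos \<theta>)\<^sup>2) * ((x $ i)\<^sup>2 + (x $ j)\<^sup>2)"
    by (simp only: power2_eq_square) algebra
  then show "norm (plane_rotation i j \<theta> x) = norm x"
    using assms by (simp add: norm_vec_def L2_set_def split plane_rotation_def)
qed

context rotation_invariant
begin

text \<open>Rotating the (i, j) plane by \<phi> / 2 turns 2 x_i x_j into sin \<phi> (x_i^2 - x_j^2)
  + cos \<phi> (2 x_i x_j), whose mean modulus does not depend on \<phi>. Integrated over \<phi> in
  [0, pi] first, the modulus becomes 2 (x_i^2 + x_j^2), of mean 4 / d. Comparing both orders of
  integration gives 2 q pi = 4 / d for the mean q sought.\<close>

lemma integral_abs_product_component:
  assumes "i \<noteq> j"
  shows "(\<integral>x. \<bar>x $ i * x $ j\<bar> \<partial>N) = 2 / (pi * CARD('n))"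
proof -
  let ?q = "\<integral>x. \<bar>x $ i * x $ j\<bar> \<partial>N"
  define F where "F \<phi> x = \<bar>sin \<phi> * ((x $ i)\<^sup>2 - (x $ j)\<^sup>2) + cos \<phi> * (2 * (x $ i * x $ j))\<bar>"
    for \<phi> and x :: "real^'n"
  interpret P: pair_sigma_finite N lborel ..
  have [measurable]: "(\<lambda>x. x $ k) \<in> borel_measurable N" for k
    by (intro measurable_continuous continuous_intros)
  have cont: "continuous_on UNIV (F \<phi>)" for \<phi>
    unfolding F_def by (intro continuous_intros)
  have F: "(\<integral>x. F \<phi> x \<partial>N) = 2 * ?q" for \<phi>
  proof -
    have "2 * (sin (\<phi> / 2) * cos (\<phi> / 2)) = sin \<phi>" "(cos (\<phi> / 2))\<^sup>2 - (sin (\<phi> / 2))\<^sup>2 = cos \<phi>"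
      using sin_double[of "\<phi> / 2"] cos_double[of "\<phi> / 2"] by simp_all
    note half = this
    have "2 * ((cos (\<phi> / 2) * x - sin (\<phi> / 2) * y) * (sin (\<phi> / 2) * x + cos (\<phi> / 2) * y))
        = sin \<phi> * (x\<^sup>2 - y\<^sup>2) + cos \<phi> * (2 * (x * y))" for x y
      unfolding half[symmetric] by algebra
    then have "F \<phi> x = \<bar>2 * (plane_rotation i j (\<phi> / 2) x $ i * plane_rotation i j (\<phi> / 2) x $ j)\<bar>" for x
      using assms not_sym[OF assms] by (simp only: plane_rotation_def F_def vec_lambda_beta if_True if_False refl)
    then have eq: "F \<phi> = (\<lambda>x. 2 * \<bar>plane_rotation i j (\<phi> / 2) x $ i * plane_rotation i j (\<phi> / 2) x $ j\<bar>)"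
      by (simp add: abs_mult fun_eq_iff)
    show ?thesis
      unfolding eq using integral_rotate[OF orthogonal_plane_rotation[OF assms], of "\<lambda>x. 2 * \<bar>x $ i * x $ j\<bar>" "\<phi> / 2"]
      by (simp add: continuous_on_mult_left continuous_on_rabs continuous_on_mult continuous_on_component)
  qed
  have "ennreal (2 * ?q * pi) = (\<integral>\<^sup>+ \<phi>. ennreal (2 * ?q) * indicator {0..pi} \<phi> \<partial>lborel)"
    by (simp add: nn_integral_cmult_indicator ennreal_mult')
  also have "\<dots> = (\<integral>\<^sup>+ \<phi>. (\<integral>\<^sup>+ x. ennreal (indicator {0..pi} \<phi> * F \<phi> x) \<partial>N) \<partial>lborel)"
  proof (intro nn_integral_cong)
    fix \<phi>
    have "(\<integral>\<^sup>+ x. ennreal (F \<phi> x) \<partial>N) = ennreal (2 * ?q)"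
      unfolding F[of \<phi>, symmetric]
      by (rule nn_integral_eq_integral[OF integrable_continuous[OF cont]]) (simp add: F_def)
    then show "ennreal (2 * ?q) * indicator {0..pi} \<phi> = (\<integral>\<^sup>+ x. ennreal (indicator {0..pi} \<phi> * F \<phi> x) \<partial>N)"
      by (auto simp: indicator_def)
  qed
  also have "\<dots> = (\<integral>\<^sup>+ x. (\<integral>\<^sup>+ \<phi>. ennreal (indicator {0..pi} \<phi> * F \<phi> x) \<partial>lborel) \<partial>N)"
    unfolding F_def by (rule P.Fubini') measurable
  also have "\<dots> = (\<integral>\<^sup>+ x. ennreal (2 * ((x $ i)\<^sup>2 + (x $ j)\<^sup>2)) \<partial>N)"
  proof (intro nn_integral_cong)
    fix x :: "real^'n"
    have "((x $ i)\<^sup>2 - (x $ j)\<^sup>2)\<^sup>2 + (2 * (x $ i * x $ j))\<^sup>2 = ((x $ i)\<^sup>2 + (x $ j)\<^sup>2)\<^sup>2"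
      by (simp only: power2_eq_square) algebra
    then have int: "((\<lambda>\<phi>. F \<phi> x) has_integral (2 * ((x $ i)\<^sup>2 + (x $ j)\<^sup>2))) {0..pi}"
      using has_integral_abs_sin_cos[of "(x $ i)\<^sup>2 - (x $ j)\<^sup>2" "2 * (x $ i * x $ j)"]
      unfolding F_def by simp
    show "(\<integral>\<^sup>+ \<phi>. ennreal (indicator {0..pi} \<phi> * F \<phi> x) \<partial>lborel) = ennreal (2 * ((x $ i)\<^sup>2 + (x $ j)\<^sup>2))"
      by (intro nn_integral_has_integral_lebesgue[OF _ int]) (simp add: F_def)
  qed
  also have "\<dots> = ennreal (\<integral>x. 2 * ((x $ i)\<^sup>2 + (x $ j)\<^sup>2) \<partial>N)"
    by (intro nn_integral_eq_integral integrable_continuous continuous_intros) auto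
  also have "(\<integral>x. 2 * ((x $ i)\<^sup>2 + (x $ j)\<^sup>2) \<partial>N) = 4 / CARD('n)"
    by (simp add: integral_square_component integrable_continuous continuous_on_power continuous_on_component)
  finally have "2 * ?q * pi = 4 / CARD('n)"
    by simp
  then show ?thesis
    by (simp add: field_simps)
qed

text \<open>On the sphere this is the cosine of the angle between x and the nearest vertex of
  \<open>cube\<close>.\<close>

definition Z :: "real^'n \<Rightarrow> real" where
  "Z x = (\<Sum>i\<in>UNIV. \<bar>x $ i\<bar>) / sqrt CARD('n)"

lemma continuous_on_Z [continuous_intros]: "continuous_on S Z"
  unfolding Z_def by (intro continuous_intros) auto

lemma Z_bounds:
  assumes "norm x = 1"
  shows "0 \<le> Z x" "Z x \<le> 1"
proof -
  show "0 \<le> Z x" by (simp add: Z_def sum_nonneg)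
  have "(\<Sum>i\<in>UNIV. \<bar>x $ i\<bar>) \<le> L2_set (\<lambda>i. x $ i) UNIV * L2_set (\<lambda>i. 1) (UNIV::'n set)"
    using L2_set_mult_ineq[of "\<lambda>i. x $ i" "\<lambda>i. 1" "UNIV::'n set"] by simp
  then show "Z x \<le> 1"
    using assms by (simp add: Z_def norm_vec_def L2_set_def)
qed

lemma integral_Z: "(\<integral>x. Z x \<partial>N) = sqrt CARD('n) * mean_abs"
proof -
  have "(\<integral>x. Z x \<partial>N) = (\<Sum>i\<in>UNIV. (\<integral>x. \<bar>x $ i\<bar> \<partial>N)) / sqrt CARD('n)"
    unfolding Z_def by (subst Bochner_Integration.integral_sum[symmetric])
       (auto intro!: integrable_continuous continuous_intros)
  then show ?thesis
    by (simp add: integral_abs_component real_div_sqrt flip: times_divide_eq_left)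
qed

lemma integral_Z_square:
  "(\<integral>x. (Z x)\<^sup>2 \<partial>N) = 1 / CARD('n) + 2 / pi * (1 - 1 / CARD('n))"
proof -
  let ?d = "real CARD('n)"
  have int: "integrable N (\<lambda>x. \<bar>x $ i * x $ j\<bar>)" for i j
    by (intro integrable_continuous continuous_intros)
  have "(Z x)\<^sup>2 = (\<Sum>i\<in>UNIV. \<Sum>j\<in>UNIV. \<bar>x $ i * x $ j\<bar>) / ?d" for x
    by (simp add: Z_def power_divide power2_eq_square sum_product abs_mult)
  then have "(\<integral>x. (Z x)\<^sup>2 \<partial>N) = (\<Sum>i\<in>UNIV. \<Sum>j\<in>UNIV. (\<integral>x. \<bar>x $ i * x $ j\<bar> \<partial>N)) / ?d"
    by (simp add: Bochner_Integration.integral_sum int)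
  \<comment> \<open>Every entry gets the off-diagonal value, and the diagonal is then corrected to 1
    / d.\<close>
  also have "(\<Sum>i\<in>UNIV. \<Sum>j\<in>UNIV. (\<integral>x. \<bar>x $ i * x $ j\<bar> \<partial>N)) =
      (\<Sum>i::'n\<in>UNIV. \<Sum>j::'n\<in>UNIV. 2 / (pi * ?d) + (if i = j then 1 / ?d - 2 / (pi * ?d) else 0))"
    by (intro sum.cong) (auto simp: integral_abs_product_component integral_square_component
      simp flip: power2_eq_square)
  also have "\<dots> = ?d * (?d * (2 / (pi * ?d))) + ?d * (1 / ?d - 2 / (pi * ?d))"
    by (simp add: sum.distrib distrib_left)
  finally have "(\<integral>x. (Z x)\<^sup>2 \<partial>N) = (?d * (?d * (2 / (pi * ?d))) + ?d * (1 / ?d - 2 / (pi * ?d))) / ?d" .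
  moreover have "(D * (D * (2 / (pi * D))) + D * (1 / D - 2 / (pi * D))) / D = 1 / D + 2 / pi * (1 - 1 / D)"
    if "D \<noteq> 0" for D :: real
    using that by (simp add: field_simps)
  ultimately show ?thesis
    by simp
qed

end

section \<open>Lower bound for the mean distance to the cube\<close>

text \<open>With r = sqrt (y / b), twice the gap divided by sqrt b is r (r - 1)^2 (r + 2). The
  minorant is tangent to the square root at y = b, so with b the mean of y the expectation loses
  only the relative amount Var / (2 b^2).\<close>

lemma sqrt_ge_quadratic:
  assumes "0 \<le> y" "0 < b"
  shows "sqrt b * (3 * (y / b) - (y / b)\<^sup>2) / 2 \<le> sqrt y"
proof -
  define r where "r = sqrt (y / b)"
  have r: "0 \<le> r" "y / b = r\<^sup>2" using assms by (auto simp: r_def)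
  have "0 \<le> r * ((r - 1)\<^sup>2 * (r + 2))" using r by simp
  also have "\<dots> = 2 * r - (3 * r\<^sup>2 - (r\<^sup>2)\<^sup>2)" by (simp only: power2_eq_square) algebra
  finally have "(3 * (y / b) - (y / b)\<^sup>2) / 2 \<le> r" using r by simp
  then have "sqrt b * ((3 * (y / b) - (y / b)\<^sup>2) / 2) \<le> sqrt b * r"
    using assms by (intro mult_left_mono) auto
  then show ?thesis using assms by (simp add: r_def real_sqrt_divide)
qed

text \<open>Here \<open>z\<close>, \<open>W\<close> and \<open>e\<close> are the expectations of \<open>Z\<close>, \<open>Z\<^sup>2\<close> and \<open>sqrt (1 - Z)\<close>. With \<open>a = 1 - m\<close>,
  the bound \<open>e1\<close> suffices while \<open>(d - 1) * a\<^sup>2 \<le> 1 / 2\<close>; beyond that \<open>e2\<close> loses at most the relative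
  error \<open>q = 1 / (4 * (d - 1) * a\<^sup>2)\<close>, which the target loses as well: through \<open>sqrt (a - t)\<close> when
  \<open>t \<ge> 2 * q * a\<close>, and through the exponential otherwise.\<close>

lemma sqrt_tail_bound:
  fixes d z e t :: real
  assumes d: "8 \<le> d"
    and z: "sqrt (2 / pi) \<le> z" "z\<^sup>2 \<le> W" and W: "W = 1 / d + 2 / pi * (1 - 1 / d)"
    and m: "m = sqrt (2 / pi) * sqrt (d / (d - 1))"
    and t: "0 \<le> t" "t \<le> 1 - m"
    and e1: "1 - z \<le> e"
    and e2: "sqrt (1 - z) * (1 - (W - z\<^sup>2) / (2 * (1 - z)\<^sup>2)) \<le> e"
  shows "sqrt (1 - m - t) * (1 - exp (- (d - 1) * t\<^sup>2 / 2)) \<le> e"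
proof -
  define a where "a = 1 - m"
  have pi: "3 \<le> pi" using pi_approx by simp
  have m2: "m\<^sup>2 = 2 / pi * (d / (d - 1))"
    using d by (simp add: m power_mult_distrib)
  have z0: "0 \<le> z" by (rule order_trans[OF _ z(1)]) simp
  have m0: "0 \<le> m" using d by (simp add: m)
  have z2: "2 / pi \<le> z\<^sup>2"
    using power_mono[OF z(1), of 2] by simp
  \<comment> \<open>The variance is largest when z^2 takes its lower bound 2 / pi, and pi < 4 gives
    1 - 2 / pi <= 1 / 2.\<close>
  have V: "W - z\<^sup>2 \<le> 1 / (2 * (d - 1))"
  proof -
    have "W - 2 / pi = (1 - 2 / pi) / d" by (simp add: W algebra_simps diff_divide_distrib)
    then have "W - z\<^sup>2 \<le> (1 - 2 / pi) / d" using z2 by simp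
    also have "\<dots> \<le> (1 / 2) / d"
      using pi d pi_less_4 by (intro divide_right_mono) (auto simp: field_simps)
    also have "\<dots> \<le> 1 / (2 * (d - 1))" using d by (simp add: field_simps)
    finally show ?thesis .
  qed
  \<comment> \<open>The difference is at least (4 / pi - 1) / d, positive since pi < 4; with z^2 <=
    W this yields z <= m.\<close>
  have "W \<le> m\<^sup>2"
  proof -
    have "m\<^sup>2 - W = (2 / pi * (1 / d + 1 / (d - 1)) - 1 / d)"
      using d by (simp add: m2 W field_simps)
    moreover have "1 / d \<le> 1 / (d - 1)" using d by (simp add: field_simps)
    then have "2 / pi * (1 / d + 1 / d) \<le> 2 / pi * (1 / d + 1 / (d - 1))"
      by (intro mult_left_mono) auto
    moreover have "1 / d \<le> 2 / pi * (1 / d + 1 / d)"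
      using pi_less_4 d pi by (simp add: field_simps)
    ultimately show ?thesis by linarith
  qed
  then have zm: "z \<le> m"
    using power2_le_imp_le[OF order_trans[OF z(2)] m0] by blast
  \<comment> \<open>From d >= 8, m^2 <= 16 / 21. The crude value 15 / 16 is chosen to give sqrt a >=
    1 / 4 below.\<close>
  have "m \<le> 15 / 16"
  proof (rule power2_le_imp_le)
    have "2 / pi \<le> 2 / 3" using pi by (simp add: field_simps)
    moreover have "d / (d - 1) \<le> 8 / 7" using d by (simp add: field_simps)
    ultimately have "m\<^sup>2 \<le> (2 / 3) * (8 / 7)"
      unfolding m2 using d by (intro mult_mono) auto
    then show "m\<^sup>2 \<le> (15 / 16)\<^sup>2" by (simp add: power2_eq_square)
  qed simp
  then have a: "1 / 16 \<le> a" by (simp add: a_def)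
  have b: "a \<le> 1 - z" using zm by (simp add: a_def)
  have ta: "t \<le> a" using t by (simp add: a_def)
  define x where "x = (d - 1) * t\<^sup>2 / 2"
  have x0: "0 \<le> x" using d by (simp add: x_def)
  have ex: "1 - exp (- x) \<le> x" "0 \<le> 1 - exp (- x)" "1 - exp (- x) \<le> 1"
    using exp_ge_add_one_self[of "- x"] x0 by auto
  have st: "sqrt (a - t) \<le> sqrt a" using t by simp
  have rhs_x: "sqrt (a - t) * (1 - exp (- x)) \<le> sqrt a * x"
    using st ex a ta by (intro mult_mono) auto
  have goal: "sqrt (a - t) * (1 - exp (- x)) \<le> e"
  proof (cases "(d - 1) * a\<^sup>2 \<le> 1 / 2")
    case True
    have "x \<le> (d - 1) * a\<^sup>2 / 2"
      unfolding x_def using d ta t by (intro divide_right_mono mult_left_mono power_mono) auto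
    then have "x \<le> 1 / 4" using True by simp
    \<comment> \<open>Thus x <= sqrt a, and the target is at most sqrt a * x <= a <= 1 - z <=
      e.\<close>
    also have "1 / 4 \<le> sqrt a"
      using a by (intro real_le_rsqrt) (simp add: power2_eq_square)
    finally have "sqrt a * x \<le> sqrt a * sqrt a"
      using a by (intro mult_left_mono) auto
    then show ?thesis using rhs_x a b e1 by simp
  next
    case False
    define q where "q = 1 / (4 * (d - 1) * a\<^sup>2)"
    \<comment> \<open>The threshold 1 / 2 of the case split is exactly what makes q < 1 / 2.\<close>
    have q: "0 < q" "q < 1 / 2"
      using False d a by (auto simp: q_def field_simps)
    have "(W - z\<^sup>2) / (2 * (1 - z)\<^sup>2) \<le> (1 / (2 * (d - 1))) / (2 * a\<^sup>2)"
      using V a b d z(2) by (intro frac_le mult_left_mono power_mono) auto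
    also have "\<dots> = q" by (simp add: q_def)
    finally have "1 - q \<le> 1 - (W - z\<^sup>2) / (2 * (1 - z)\<^sup>2)" by simp
    then have "sqrt a * (1 - q) \<le> sqrt (1 - z) * (1 - (W - z\<^sup>2) / (2 * (1 - z)\<^sup>2))"
      using a b q by (intro mult_mono) auto
    with e2 have e: "sqrt a * (1 - q) \<le> e" by linarith
    show ?thesis
    proof (cases "2 * q * a \<le> t")
      case True
      have "a - t \<le> a * (1 - q)\<^sup>2"
      proof -
        have "a * (1 - q)\<^sup>2 = a - 2 * q * a + a * q\<^sup>2" by (simp add: power2_eq_square algebra_simps)
        moreover have "0 \<le> a * q\<^sup>2" using a by simp
        ultimately show ?thesis using True by linarith
      qed
      then have "sqrt (a - t) \<le> sqrt (a * (1 - q)\<^sup>2)" by simp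
      also have "\<dots> = sqrt a * (1 - q)" using q by (simp add: real_sqrt_mult)
      finally have "sqrt (a - t) \<le> sqrt a * (1 - q)" .
      moreover have "sqrt (a - t) * (1 - exp (- x)) \<le> sqrt (a - t) * 1"
        using ex ta by (intro mult_left_mono) auto
      ultimately show ?thesis using e by linarith
    next
      case False
      then have "x \<le> (d - 1) * (2 * q * a)\<^sup>2 / 2"
        unfolding x_def using d t by (intro divide_right_mono mult_left_mono power_mono) auto
      also have "\<dots> = (4 * (d - 1) * a\<^sup>2) * q * q / 2" by (simp add: power2_eq_square)
      also have "(4 * (d - 1) * a\<^sup>2) * q = 1" using d a by (simp add: q_def)
      \<comment> \<open>The chain has reached x <= q / 2, and q < 1 / 2 bounds this by 1 -
        q.\<close>
      finally have "x \<le> 1 - q" using q by simp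
      then have "sqrt a * x \<le> sqrt a * (1 - q)" using a by (intro mult_left_mono) auto
      then show ?thesis using rhs_x e by linarith
    qed
  qed
  have "x = (d - 1) * t\<^sup>2 / 2" by (rule x_def)
  then have "- x = - (d - 1) * t\<^sup>2 / 2" by (simp add: algebra_simps)
  with goal show ?thesis by (simp add: a_def)
qed

context rotation_invariant
begin

text \<open>The moments of \<open>Z\<close> are fed into \<open>sqrt_tail_bound\<close>. Its premise
  \<open>e1\<close> comes from y <= sqrt y on [0, 1], and \<open>e2\<close> from the quadratic
  minorant of sqrt at the mean of 1 - Z.\<close>

lemma integral_sqrt_ge:
  assumes d: "CARD('n) \<ge> 8" and t: "0 \<le> t" "t \<le> 1 - m_d CARD('n)"
  shows "sqrt (1 - m_d CARD('n) - t) * (1 - exp (- (real CARD('n) - 1) * t\<^sup>2 / 2))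
    \<le> (\<integral>x. sqrt (1 - Z x) \<partial>N)"
proof (rule sqrt_tail_bound[where z = "\<integral>x. Z x \<partial>N" and W = "\<integral>x. (Z x)\<^sup>2 \<partial>N"])
  let ?z = "\<integral>x. Z x \<partial>N" and ?W = "\<integral>x. (Z x)\<^sup>2 \<partial>N"
  have int: "integrable N Z" "integrable N (\<lambda>x. (Z x)\<^sup>2)" "integrable N (\<lambda>x. sqrt (1 - Z x))"
    by (intro integrable_continuous continuous_intros)+
  have "0 \<le> (\<integral>x. (Z x - ?z)\<^sup>2 \<partial>N)" by simp
  also have "\<dots> = ?W - ?z\<^sup>2"
    using int by (intro variance_eq)
  finally show "?z\<^sup>2 \<le> ?W" by simp
  have "1 - ?z = (\<integral>x. 1 - Z x \<partial>N)"
    using int by (simp add: prob_space)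
  also have "\<dots> \<le> (\<integral>x. sqrt (1 - Z x) \<partial>N)"
  proof (rule integral_mono_AE)
    show "AE x in N. 1 - Z x \<le> sqrt (1 - Z x)"
      using AE_norm
    proof eventually_elim
      case (elim x)
      then have "0 \<le> 1 - Z x" "1 - Z x \<le> 1" using Z_bounds by auto
      then show ?case by (intro real_le_rsqrt) (simp add: power2_eq_square mult_left_le)
    qed
  qed (use int in auto)
  finally show "1 - ?z \<le> (\<integral>x. sqrt (1 - Z x) \<partial>N)" .
  show "sqrt (1 - ?z) * (1 - (?W - ?z\<^sup>2) / (2 * (1 - ?z)\<^sup>2)) \<le> (\<integral>x. sqrt (1 - Z x) \<partial>N)"
  \<comment> \<open>In the degenerate case the quotient is a division by zero, but the factor sqrt 0
    makes the left side 0.\<close>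
  proof (cases "1 - ?z = 0")
    case True
    then show ?thesis using \<open>1 - ?z \<le> (\<integral>x. sqrt (1 - Z x) \<partial>N)\<close> by simp
  next
    case False
    define b where "b = 1 - ?z"
    have "0 \<le> (\<integral>x. 1 - Z x \<partial>N)"
      using AE_norm Z_bounds by (intro integral_nonneg_AE) (auto elim!: eventually_mono)
    then have b: "0 < b" using False int by (simp add: b_def prob_space)
    define S where "S = (\<integral>x. (1 - Z x)\<^sup>2 \<partial>N)"
    have "S = 1 - 2 * ?z + ?W"
      unfolding S_def using int by (simp add: power2_diff prob_space)
    then have V: "?W - ?z\<^sup>2 = S - b\<^sup>2"
      by (simp add: b_def power2_eq_square algebra_simps)
    then have "sqrt b * (1 - (?W - ?z\<^sup>2) / (2 * b\<^sup>2)) = sqrt b * (3 * (b / b) - S / b\<^sup>2) / 2"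
      unfolding V using b by (simp add: field_simps)
    also have "\<dots> = (\<integral>x. sqrt b * (3 * ((1 - Z x) / b) - ((1 - Z x) / b)\<^sup>2) / 2 \<partial>N)"
    proof -
      have lin: "(\<integral>x. sqrt b * (3 * (Y x / b) - (Y x / b)\<^sup>2) / 2 \<partial>N) =
          sqrt b * (3 * ((\<integral>x. Y x \<partial>N) / b) - (\<integral>x. (Y x)\<^sup>2 \<partial>N) / b\<^sup>2) / 2"
        if "integrable N Y" "integrable N (\<lambda>x. (Y x)\<^sup>2)" for Y :: "real^'n \<Rightarrow> real"
        using that by (simp add: power_divide)
      have "(\<integral>x. 1 - Z x \<partial>N) = b"
        using int by (simp add: b_def prob_space)
      then show ?thesis
        unfolding S_def
        by (subst lin) (auto intro!: integrable_continuous continuous_intros)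
    qed
    also have "\<dots> \<le> (\<integral>x. sqrt (1 - Z x) \<partial>N)"
    proof (rule integral_mono_AE)
      show "integrable N (\<lambda>x. sqrt b * (3 * ((1 - Z x) / b) - ((1 - Z x) / b)\<^sup>2) / 2)"
        by (intro integrable_continuous continuous_intros) (use b in auto)
      show "AE x in N. sqrt b * (3 * ((1 - Z x) / b) - ((1 - Z x) / b)\<^sup>2) / 2 \<le> sqrt (1 - Z x)"
        using AE_norm
      proof eventually_elim
        case (elim x)
        show ?case
          using Z_bounds(2)[OF elim] b by (intro sqrt_ge_quadratic) auto
      qed
    qed (use int in auto)
    finally show ?thesis by (simp add: b_def)
  qed
qed (use d t mean_abs_ge in \<open>auto simp: m_d_def integral_Z integral_Z_square\<close>)

end

section \<open>The Wasserstein distance\<close>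

text \<open>Since Q (R u) = (Q R) u, left invariance of Haar measure becomes rotation invariance of
  the law of R u.\<close>

lemma rotation_invariant_X_law:
  fixes M :: "(real^'n::finite^'n) measure"
  assumes M: "haar_orthogonal M" and u: "norm u = 1"
  shows "rotation_invariant (X_law M u)"
proof -
  have setsM: "sets M = sets borel"
    and inv: "orthogonal_matrix Q \<Longrightarrow> distr M borel (\<lambda>R. Q ** R) = M" for Q :: "real^'n^'n"
    using M by (auto simp: haar_orthogonal_def)
  interpret M: prob_space M using M by (simp add: haar_orthogonal_def)
  have meas: "(\<lambda>R. R *v u) \<in> measurable M borel"
    unfolding measurable_cong_sets[OF setsM refl]
    by (auto simp: matrix_vector_mult_def intro!: borel_measurable_continuous_onI continuous_intros)
  have mult: "(\<lambda>R. Q ** R) \<in> measurable borel borel" for Q :: "real^'n^'n"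
    unfolding matrix_matrix_mult_def
    by (intro borel_measurable_continuous_onI continuous_intros)
  have vec: "(*v) Q \<in> measurable borel borel" for Q :: "real^'n^'n"
    by (intro borel_measurable_continuous_onI linear_continuous_on) auto
  interpret X: prob_space "X_law M u"
    unfolding X_law_def by (rule M.prob_space_distr[OF meas])
  show ?thesis
  proof
    show "sets (X_law M u) = sets borel" by (simp add: X_law_def)
    have "{R :: real^'n^'n. orthogonal_matrix R} \<in> sets M"
    \<comment> \<open>Non-measurable sets have \<open>emeasure\<close> 0, so the value 1 forces
      measurability.\<close>
    proof (rule ccontr)
      assume "\<not> ?thesis"
      then show False using M by (simp add: haar_orthogonal_def emeasure_notin_sets)
    qed
    then have "AE R in M. orthogonal_matrix R"
      using M M.AE_in_set_eq_1[of "{R. orthogonal_matrix R}"]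
      by (simp add: haar_orthogonal_def M.emeasure_eq_measure)
    then have "AE R in M. norm (R *v u) = 1"
      by eventually_elim (simp add: norm_orthogonal_matrix_vector u)
    then show "AE x in X_law M u. norm x = 1"
      unfolding X_law_def by (subst AE_distr_iff[OF meas]) auto
    fix Q :: "real^'n^'n"
    assume Q: "orthogonal_matrix Q"
    have "distr (X_law M u) borel ((*v) Q) = distr M borel (\<lambda>R. (Q ** R) *v u)"
      unfolding X_law_def by (subst distr_distr[OF vec meas]) (simp add: comp_def matrix_vector_mul_assoc)
    also have "\<dots> = distr (distr M borel (\<lambda>R. Q ** R)) borel (\<lambda>R. R *v u)"
      using mult meas by (subst distr_distr)
        (auto simp: comp_def measurable_cong_sets[OF setsM refl])
    also have "\<dots> = X_law M u" by (simp add: inv[OF Q] X_law_def)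
    finally show "distr (X_law M u) borel ((*v) Q) = X_law M u" .
  qed
qed

text \<open>A real supremum is only usable with an upper bound on its family. On the unit sphere f
  stays within 1 of f 0, hence so does each mean.\<close>

lemma lipschitz_integral_diff_le:
  fixes f :: "real^'n::finite \<Rightarrow> real" and P Q :: "(real^'n::finite) measure"
  assumes P: "prob_space P" "AE x in P. norm x = 1" "(\<lambda>x. x) \<in> borel_measurable P"
    and Q: "prob_space Q" "AE x in Q. norm x = 1" "(\<lambda>x. x) \<in> borel_measurable Q"
    and f: "1-lipschitz_on UNIV f"
  shows "\<bar>(\<integral>x. f x \<partial>P) - (\<integral>x. f x \<partial>Q)\<bar> \<le> 2"
proof -
  have close: "\<bar>(\<integral>x. f x \<partial>R) - f 0\<bar> \<le> 1"
    if R: "prob_space R" "AE x in R. norm x = 1" "(\<lambda>x. x) \<in> borel_measurable R" for R :: "(real^'n) measure"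
  proof -
    interpret prob_space R by fact
    have ae: "AE x in R. \<bar>f x - f 0\<bar> \<le> 1"
      using R(2)
    proof eventually_elim
      case (elim x)
      then show ?case using lipschitz_onD[OF f, of x 0] by (simp add: dist_real_def)
    qed
    have meas: "f \<in> borel_measurable R"
      using measurable_compose[OF R(3) borel_measurable_continuous_onI[OF lipschitz_on_continuous_on[OF f]]] .
    have int: "integrable R (\<lambda>x. f x - f 0)"
      using ae meas by (intro integrable_const_bound[of _ 1]) auto
    then have "integrable R f"
      using Bochner_Integration.integrable_add[OF int, of "\<lambda>_. f 0"] by simp
    then have "(\<integral>x. f x \<partial>R) - f 0 = (\<integral>x. f x - f 0 \<partial>R)" by (simp add: prob_space)
    moreover have "\<bar>\<integral>x. f x - f 0 \<partial>R\<bar> \<le> (\<integral>x. \<bar>f x - f 0\<bar> \<partial>R)"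
      by (rule integral_abs_bound)
    moreover have "(\<integral>x. \<bar>f x - f 0\<bar> \<partial>R) \<le> 1"
      using ae int by (intro integral_le_const) auto
    ultimately show ?thesis by linarith
  qed
  show ?thesis
    using close[OF P] close[OF Q] by linarith
qed

lemma lipschitz_test_le_W1:
  fixes f :: "real^'n::finite \<Rightarrow> real" and P Q :: "(real^'n::finite) measure"
  assumes P: "prob_space P" "AE x in P. norm x = 1" "(\<lambda>x. x) \<in> borel_measurable P"
    and Q: "prob_space Q" "AE x in Q. norm x = 1" "(\<lambda>x. x) \<in> borel_measurable Q"
    and f: "1-lipschitz_on UNIV f"
  shows "\<bar>(\<integral>x. f x \<partial>P) - (\<integral>x. f x \<partial>Q)\<bar> \<le> W1 P Q"
  unfolding W1_def
  by (rule cSUP_upper) (use f lipschitz_integral_diff_le[OF P Q] in \<open>auto intro!: bdd_aboveI[of _ 2]\<close>)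

text \<open>Makes the outer supremum over u bounded.\<close>

lemma W1_le:
  fixes P Q :: "(real^'n::finite) measure"
  assumes P: "prob_space P" "AE x in P. norm x = 1" "(\<lambda>x. x) \<in> borel_measurable P"
    and Q: "prob_space Q" "AE x in Q. norm x = 1" "(\<lambda>x. x) \<in> borel_measurable Q"
  shows "W1 P Q \<le> 2"
  unfolding W1_def
proof (rule cSUP_least)
  have "(\<lambda>x. 0) \<in> {f :: real^'n \<Rightarrow> real. 1-lipschitz_on UNIV f}"
    by (auto simp: lipschitz_on_def)
  then show "{f :: real^'n \<Rightarrow> real. 1-lipschitz_on UNIV f} \<noteq> {}" by blast
qed (use lipschitz_integral_diff_le[OF P Q] in auto)


theorem mainTheorem10:
  fixes m :: nat and ix :: "'n::finite \<Rightarrow> nat" and M :: "(real^'n^'n) measure" and t :: real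
  assumes "CARD('n) = 2 ^ m" and "CARD('n) \<ge> 8"
    and "bij_betw ix UNIV {..<CARD('n)}"
    and "haar_orthogonal M"
    and "0 \<le> t" and "t \<le> 1 - m_d CARD('n)"
  shows "(SUP u \<in> sphere (0::real^'n) 1. W1 (T_law m ix u) (X_law M u))
           \<ge> sqrt (2 * (1 - m_d CARD('n) - t))
               * (1 - exp (- (real CARD('n) - 1) * t ^ 2 / 2))"
proof -
  interpret H: normalized_hadamard m ix
    using assms by unfold_locales
  let ?A = "H.A" and ?d = "real CARD('n)"
  \<comment> \<open>Any coordinate vector serves as the witness direction.\<close>
  define u :: "real^'n" where "u = axis undefined 1"
  have u: "norm u = 1" by (simp add: u_def)
  interpret X: rotation_invariant "X_law M u"
    by (rule rotation_invariant_X_law[OF \<open>haar_orthogonal M\<close> u])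
  have T: "prob_space (T_law m ix v)" "AE x in T_law m ix v. norm x = 1"
    "(\<lambda>x. x) \<in> borel_measurable (T_law m ix v)" if "norm v = 1" for v :: "real^'n"
    using H.AE_norm_T_law[of v] that by (auto simp: T_law_def measure_pmf.prob_space_axioms)
  have X: "prob_space (X_law M v)" "AE x in X_law M v. norm x = 1"
    "(\<lambda>x. x) \<in> borel_measurable (X_law M v)" if "norm v = 1" for v :: "real^'n"
  proof -
    interpret rotation_invariant "X_law M v"
      by (rule rotation_invariant_X_law[OF \<open>haar_orthogonal M\<close> that])
    show "prob_space (X_law M v)" "AE x in X_law M v. norm x = 1"
      "(\<lambda>x. x) \<in> borel_measurable (X_law M v)"
      using prob_space_axioms AE_norm by (auto simp: measurable_cong_sets[OF sets_N refl])
  qed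
  \<comment> \<open>The test function is the distance to the image of the cube under
    \<open>?A\<close>, measured after undoing \<open>?A\<close>. It vanishes almost surely at T(u),
    and it is 1-Lipschitz because \<open>transpose ?A\<close> is an isometry.\<close>
  define f where "f x = infdist (transpose ?A *v x) cube" for x
  have orth: "orthogonal_matrix (transpose ?A)"
    using H.orthogonal_A by simp
  have f: "1-lipschitz_on UNIV f"
  proof (rule lipschitz_onI)
    fix x y
    have "dist (f x) (f y) \<le> dist (transpose ?A *v x) (transpose ?A *v y)"
      unfolding f_def dist_real_def by (rule infdist_triangle_abs)
    also have "\<dots> = 1 * dist x y"
      using norm_orthogonal_matrix_vector[OF orth, of "x - y"]
      by (simp add: dist_norm matrix_vector_mult_diff_distrib del: transpose_matrix_vector)
    finally show "dist (f x) (f y) \<le> 1 * dist x y" .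
  qed simp
  have "AE x in T_law m ix u. f x = 0"
    unfolding u_def using H.AE_T_law_axis by (rule AE_mp) (simp add: f_def)
  then have fT: "(\<integral>x. f x \<partial>T_law m ix u) = 0"
    by (rule integral_eq_zero_AE)
  have "sqrt (2 * (1 - m_d CARD('n) - t)) * (1 - exp (- (?d - 1) * t ^ 2 / 2)) \<le>
      sqrt 2 * (\<integral>x. sqrt (1 - X.Z x) \<partial>X_law M u)"
    using mult_left_mono[OF X.integral_sqrt_ge[OF assms(2,5,6)], of "sqrt 2"]
    unfolding real_sqrt_mult[of 2] mult.assoc by simp
  also have "\<dots> = (\<integral>x. sqrt (2 * (1 - X.Z x)) \<partial>X_law M u)"
    unfolding real_sqrt_mult[of 2] by simp
  also have "\<dots> \<le> (\<integral>x. infdist x cube \<partial>X_law M u)"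
  proof (rule integral_mono_AE)
    show "AE x in X_law M u. sqrt (2 * (1 - X.Z x)) \<le> infdist x cube"
      using X.AE_norm unfolding X.Z_def by eventually_elim (rule infdist_cube_ge)
  qed (intro X.integrable_continuous continuous_intros)+
  \<comment> \<open>Rotation invariance absorbs \<open>transpose ?A\<close>.\<close>
  also have "\<dots> = (\<integral>x. f x \<partial>X_law M u)"
    unfolding f_def using orth
    by (intro X.integral_rotate[symmetric] continuous_intros)
       (simp add: orthogonal_transformation_matrix del: transpose_matrix_vector)
  also have "\<dots> \<le> W1 (T_law m ix u) (X_law M u)"
    using lipschitz_test_le_W1[OF T[OF u] X[OF u] f] fT by simp
  also have "\<dots> \<le> (SUP u \<in> sphere (0::real^'n) 1. W1 (T_law m ix u) (X_law M u))"
    using u W1_le[OF T X] by (intro cSUP_upper) (auto intro!: bdd_aboveI[of _ 2])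
  finally show ?thesis .
qed

end
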